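(* For all integers $n\ge k\ge1$, $$a_{2n,k}=(n-k)a_{2n-1,k-1}+(k+1)a_{2n-1,k},$$ $$a_{2n+1,k}=(n-k+1)a_{2n,k-2}+(n+1)a_{2n,k-1}+(k+1)a_{2n,k},$$ and for all $n\ge1$, $a_{n,0}=1$ and $a_{n,\lfloor (n-1)/2\rfloor}=E_n$.
   Context: For a permutation $\pi=a_1\cdots a_n$ of $[n]$, an index $i\in[n-1]$ is a descent if $a_i>a_{i+1}$. $a_{n,k}$ is the number of $\pi\in\mathfrak S_n$ having exactly $k$ descents at even positions and no descents at odd positions; in particular $a_{n,k}=0$ if $k<0$ or $k>\lfloor (n-1)/2\rfloor$. $E_n$ is the Euler number, the number of alternating permutations $a_1>a_2<a_3>\cdots$ in $\mathfrak S_n$ (equivalently of reverse alternating permutations $a_1<a_2>a_3<\cdots$). *)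

theory Defs
  imports Main
begin

definition perms :: "nat \<Rightarrow> nat list set" where
  "perms n = {xs. distinct xs \<and> set xs = {1..n}}"

definition descents :: "nat list \<Rightarrow> nat set" where
  "descents xs = {i. 1 \<le> i \<and> i < length xs \<and> xs ! (i - 1) > xs ! i}"

definition a :: "nat \<Rightarrow> int \<Rightarrow> nat" where
  "a n k = (if k < 0 then 0 else
     card {xs \<in> perms n. (\<forall>i\<in>descents xs. even i) \<and> card (descents xs) = nat k})"

definition alternating :: "nat list \<Rightarrow> bool" where
  "alternating xs = (\<forall>i. 1 \<le> i \<and> i < length xs \<longrightarrow>
      (odd i \<longrightarrow> xs ! (i - 1) > xs ! i) \<and> (even i \<longrightarrow> xs ! (i - 1) < xs ! i))"

definition Euler :: "nat \<Rightarrow> nat" where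
  "Euler n = card {xs \<in> perms n. alternating xs}"

end

theory Submission
  imports Defs
begin

text \<open>
  A word without descents at odd positions is a sequence of ascending pairs, followed by a single
  letter if its length is odd; such words may be cut and concatenated freely at even positions.
  Deleting the maximal letter \<open>M\<close> reduces \<open>W (N + 1)\<close> to the cuts \<open>(U, V)\<close> at even positions of
  words \<open>U V\<close> in \<open>W N\<close>.

  If \<open>N\<close> is odd, then \<open>M\<close> stands at an even position and \<open>V M U\<close> corresponds to the cut \<open>(U, V)\<close>. The
  descent at \<open>M\<close> replaces the comparison at the cut, so cutting \<open>U V\<close> at position 0 or at a descent
  keeps the number of descents, and any other cut raises it by one.

  If \<open>N\<close> is even, then either \<open>M\<close> is the last letter, or both factors around \<open>M\<close> have odd length. In
  the latter case the larger of their two last letters is moved to the end of the other factor.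
  Every cut \<open>(U, V)\<close> then arises once with the moved letter at the end of \<open>V\<close> (if \<open>V\<close> is nonempty)
  and once with it at the end of \<open>U\<close> (if \<open>U\<close> is nonempty). Moving it back creates a
  descent iff \<open>last V < last U\<close> in the first case and iff \<open>last U < last V\<close> in the second, so
  a cut into nonempty words with \<open>d\<close> descents in total always contributes one word with \<open>d + 1\<close> and
  one with \<open>d + 2\<close> descents.
\<close>

section \<open>Ascending pairs and descents of words\<close>

text \<open>Consuming two letters per call confines the comparisons to odd positions without
  mentioning positions at all.\<close>

fun paired :: "'a::linorder list \<Rightarrow> bool" where
  "paired [] = True"
| "paired [x] = True"
| "paired (x # y # zs) = (x < y \<and> paired zs)"

fun des :: "'a::linorder list \<Rightarrow> nat" where
  "des [] = 0"
| "des [x] = 0"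
| "des (x # y # zs) = of_bool (y < x) + des (y # zs)"

lemma descents_Cons_Cons:
  "descents (x # y # zs) = (if y < x then {1} else {}) \<union> Suc ` descents (y # zs)"
proof (intro set_eqI)
  fix i
  show "i \<in> descents (x # y # zs) \<longleftrightarrow>
    i \<in> (if y < x then {1} else {}) \<union> Suc ` descents (y # zs)"
  proof (cases i)
    case 0
    then show ?thesis by (auto simp: descents_def)
  next
    case (Suc j)
    then show ?thesis
      by (cases j) (auto simp: descents_def image_iff)
  qed
qed

lemma descents_Nil [simp]: "descents [] = {}"
  and descents_single [simp]: "descents [x] = {}"
  by (auto simp: descents_def)

lemma finite_descents [simp]: "finite (descents xs)"
  by (rule finite_subset [of _ "{..length xs}"]) (auto simp: descents_def)

lemma zero_notin_descents [simp]: "0 \<notin> descents xs"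
  by (simp add: descents_def)

lemma card_descents: "card (descents xs) = des xs"
proof (induction xs rule: des.induct)
  case (3 x y zs)
  have "card (Suc ` descents (y # zs)) = des (y # zs)"
    using 3 by (simp add: card_image)
  moreover have "1 \<notin> Suc ` descents (y # zs)"
    by (auto simp: image_iff)
  ultimately show ?case by (simp add: descents_Cons_Cons)
qed (auto simp: descents_def)

text \<open>Removing the pair \<open>x\<close>, \<open>y\<close> shifts positions by two and so
  preserves parity. The comparison of \<open>y\<close> with the head of \<open>zs\<close> falls on
  position 2, where a descent is allowed.\<close>

lemma paired_iff_descents:
  assumes "distinct xs"
  shows "paired xs \<longleftrightarrow> (\<forall>i\<in>descents xs. even i)"
  using assms
proof (induction xs rule: paired.induct)
  case (3 x y zs)
  have "descents (y # zs) = (if zs = [] \<or> y < hd zs then {} else {1}) \<union> Suc ` descents zs"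
    if "distinct (y # zs)"
    using that by (cases zs) (auto simp: descents_Cons_Cons)
  then show ?case using 3 by (auto simp: descents_Cons_Cons)
qed auto

lemma des_append:
  "des (xs @ ys) = des xs + des ys + of_bool (xs \<noteq> [] \<and> ys \<noteq> [] \<and> hd ys < last xs)"
proof (induction xs rule: des.induct)
  case (2 x)
  then show ?case by (cases ys) auto
qed auto

lemma paired_append: "even (length xs) \<Longrightarrow> paired (xs @ ys) \<longleftrightarrow> paired xs \<and> paired ys"
  by (induction xs rule: paired.induct) auto

definition W :: "nat \<Rightarrow> nat list set" where
  "W n = {xs \<in> perms n. paired xs}"

lemma finite_perms [simp]: "finite (perms n)"
proof (rule finite_subset)
  show "perms n \<subseteq> {xs. set xs \<subseteq> {1..n} \<and> length xs \<le> n}"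
    by (auto simp: perms_def dest!: distinct_card)
qed (simp add: finite_lists_length_le)

lemma finite_W [simp]: "finite (W n)"
  by (simp add: W_def)

lemma length_perms: "xs \<in> perms n \<Longrightarrow> length xs = n"
  by (auto simp: perms_def dest!: distinct_card)

lemma less_Suc_if_perms: "xs \<in> perms n \<Longrightarrow> x \<in> set xs \<Longrightarrow> x < Suc n"
  by (simp add: perms_def)

lemma length_W: "xs \<in> W n \<Longrightarrow> length xs = n"
  by (simp add: W_def length_perms)

text \<open>The indicator form lets both recurrences follow from identities for an arbitrary weight
  \<open>F (des w)\<close>; working in \<open>int\<close> permits coefficients with
  subtraction.\<close>

lemma a_eq_sum: "int (a n (int k)) = (\<Sum>p\<in>W n. of_bool (des p = k))"
proof -
  have "{xs \<in> perms n. (\<forall>i\<in>descents xs. even i) \<and> card (descents xs) = k}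
      = {p \<in> W n. des p = k}"
    by (auto simp: W_def card_descents paired_iff_descents perms_def)
  then show ?thesis
    by (simp add: a_def Int_def)
qed

text \<open>Being a permutation does not depend on the order of the factors, so the two factors may
  trade places when the maximum is inserted between them.\<close>

lemma in_perms_Suc:
  "V @ Suc N # U \<in> perms (Suc N) \<longleftrightarrow> U @ V \<in> perms N"
proof
  assume "V @ Suc N # U \<in> perms (Suc N)"
  then have "distinct (V @ Suc N # U)" "set (V @ Suc N # U) = {1..Suc N}"
    unfolding perms_def by blast+
  then have *: "distinct (V @ U)" "Suc N \<notin> set U \<union> set V"
      "insert (Suc N) (set U \<union> set V) = {1..Suc N}"
    by (auto simp del: atLeastAtMostSuc_conv)
  then have "set U \<union> set V = {1..Suc N} - {Suc N}" by blast
  also have "\<dots> = {1..N}" by auto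
  finally show "U @ V \<in> perms N" using *(1) by (auto simp: perms_def)
next
  assume "U @ V \<in> perms N"
  then have *: "distinct (V @ U)" "set U \<union> set V = {1..N}"
    by (auto simp: perms_def)
  then have "Suc N \<notin> set U \<union> set V" by simp
  moreover have "insert (Suc N) (set U \<union> set V) = {1..Suc N}" unfolding *(2) by auto
  ultimately show "V @ Suc N # U \<in> perms (Suc N)" using *(1) by (auto simp: perms_def)
qed

section \<open>Cuts at even positions\<close>

text \<open>Pairs of factors, rather than a word with a position, allow the bijections below to be
  written by list operations. Either factor may be empty.\<close>

definition splits :: "nat \<Rightarrow> (nat list \<times> nat list) set" where
  "splits N = {(U, V). U @ V \<in> W N \<and> even (length U)}"

lemma finite_splits [simp]: "finite (splits N)"
proof (rule finite_subset)
  show "splits N \<subseteq> (\<Union>p\<in>W N. (\<lambda>i. (take i p, drop i p)) ` {..N})"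
  proof
    fix s assume "s \<in> splits N"
    then obtain U V where s: "s = (U, V)" "U @ V \<in> W N" by (auto simp: splits_def)
    then have "length U \<le> N" using length_W by fastforce
    then have "s \<in> (\<lambda>i. (take i (U @ V), drop i (U @ V))) ` {..N}"
      using s by (intro image_eqI [where x = "length U"]) auto
    then show "s \<in> (\<Union>p\<in>W N. (\<lambda>i. (take i p, drop i p)) ` {..N})"
      using s(2) by blast
  qed
qed simp

lemma sum_splits:
  "(\<Sum>(U, V)\<in>splits N. G U V)
    = (\<Sum>p\<in>W N. \<Sum>m\<in>{0..N div 2}. G (take (2 * m) p) (drop (2 * m) p))"
proof -
  have "(\<Sum>(U, V)\<in>splits N. G U V)
      = (\<Sum>(p, m)\<in>W N \<times> {0..N div 2}. G (take (2 * m) p) (drop (2 * m) p))"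
  proof (rule sum.reindex_bij_witness
      [where i = "\<lambda>(p, m). (take (2 * m) p, drop (2 * m) p)"
        and j = "\<lambda>(U, V). (U @ V, length U div 2)"], goal_cases)
    case (2 s)
    then show ?case using length_W by (fastforce simp: splits_def)
  next
    case (3 s)
    then obtain p m where "s = (p, m)" "p \<in> W N" "2 * m \<le> N" by auto
    then show ?case by (simp add: length_W)
  next
    case (4 s)
    then obtain p m where "s = (p, m)" "p \<in> W N" "2 * m \<le> N" by auto
    then show ?case by (simp add: splits_def length_W)
  qed (auto simp: splits_def)
  then show ?thesis by (simp add: sum.cartesian_product)
qed

text \<open>All descents of a word in \<open>W N\<close> lie at even positions, so summing the
  descent indicator over possible cuts strictly inside the word counts every descent.\<close>

lemma des_eq_sum:
  assumes "p \<in> W N"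
  shows "int (des p) = (\<Sum>m\<in>{1..(N - 1) div 2}. of_bool (p ! (2 * m) < p ! (2 * m - 1)))"
proof -
  let ?M = "{m \<in> {1..(N - 1) div 2}. p ! (2 * m) < p ! (2 * m - 1)}"
  have ev: "\<forall>i\<in>descents p. even i"
    using assms by (simp add: W_def perms_def flip: paired_iff_descents)
  have len: "length p = N" using assms by (rule length_W)
  have "descents p = (*) 2 ` ?M"
  proof (intro equalityI subsetI)
    fix i assume i: "i \<in> descents p"
    then obtain m where "i = 2 * m" using ev by blast
    then show "i \<in> (*) 2 ` ?M" using i len by (auto simp: descents_def)
  qed (auto simp: descents_def len)
  then have "des p = card ?M"
    by (simp add: card_image inj_on_def flip: card_descents)
  then show ?thesis by (simp add: Int_def)
qed

lemma des_take_drop: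
  assumes "0 < i" "i < length p"
  shows "des p = des (take i p) + des (drop i p) + of_bool (p ! i < p ! (i - 1))"
proof -
  have "take i p \<noteq> []" using assms by auto
  then show ?thesis
    using des_append [of "take i p" "drop i p"] assms
    by (simp add: hd_drop_conv_nth last_conv_nth min_def)
qed

section \<open>Inserting the maximum into words of odd length\<close>

text \<open>A word \<open>p\<close> has \<open>N div 2 + 1\<close> cuts: position 0 and the
  \<open>des p\<close> descents give weight \<open>F (des p)\<close>, and the remaining
  \<open>N div 2 - des p\<close> cuts give \<open>F (Suc (des p))\<close>.\<close>

lemma sum_des_odd:
  fixes F :: "nat \<Rightarrow> int"
  assumes "odd N"
  shows "(\<Sum>w\<in>W (Suc N). F (des w))
    = (\<Sum>p\<in>W N. (int (des p) + 1) * F (des p) + (int (N div 2) - int (des p)) * F (Suc (des p)))"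
proof -
  let ?\<phi> = "\<lambda>(U, V). V @ Suc N # U"
  have splitD: "odd (length V) \<and> paired U \<and> paired V \<and> V \<noteq> [] \<and>
      (\<forall>x\<in>set U \<union> set V. x < Suc N)"
    if "(U, V) \<in> splits N" for U V
  proof -
    have "U @ V \<in> W N" "even (length U)" using that by (auto simp: splits_def)
    moreover from this have "odd (length V)"
      using length_W [of "U @ V" N] assms by (auto)
    ultimately show ?thesis by (auto simp: W_def perms_def paired_append)
  qed
  have inj: "inj_on ?\<phi> (splits N)"
  proof (rule inj_onI, clarify)
    fix U V U' V'
    assume s: "(U, V) \<in> splits N" "(U', V') \<in> splits N" and eq: "V @ Suc N # U = V' @ Suc N # U'"
    have "Suc N \<notin> set V \<union> set U" "Suc N \<notin> set V' \<union> set U'"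
      using splitD [OF s(1)] splitD [OF s(2)] by blast+
    then show "U = U' \<and> V = V'" using eq by (simp add: append_Cons_eq_iff)
  qed
  have img: "W (Suc N) = ?\<phi> ` splits N"
  proof (intro equalityI subsetI)
    fix w assume "w \<in> ?\<phi> ` splits N"
    then obtain U V where w: "w = V @ Suc N # U" and s: "(U, V) \<in> splits N" by auto
    note D = splitD [OF s]
    \<comment> \<open>The last letter of \<open>V\<close> is left without a partner, and
      \<open>Suc N\<close> completes its pair.\<close>
    obtain V' y where V: "V = V' @ [y]" using D by (cases V rule: rev_cases) auto
    have "paired w"
      using D by (auto simp: w V paired_append)
    then show "w \<in> W (Suc N)"
      using s by (simp add: w W_def in_perms_Suc splits_def)
  next
    fix w assume w: "w \<in> W (Suc N)"
    then have "Suc N \<in> set w" by (auto simp: W_def perms_def)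
    then obtain V U where wVU: "w = V @ Suc N # U" by (meson split_list)
    have perm: "U @ V \<in> perms N" using w by (simp add: wVU W_def in_perms_Suc)
    then have lt: "\<forall>x\<in>set U \<union> set V. x < Suc N" by (auto simp: perms_def)
    \<comment> \<open>Otherwise \<open>Suc N\<close> would open a pair, since \<open>U\<close> would
      have odd length and hence be nonempty; but no letter of \<open>U\<close> exceeds
      \<open>Suc N\<close>.\<close>
    have "odd (length V)"
    proof
      assume e: "even (length V)"
      then have "paired (Suc N # U)" using w by (simp add: wVU W_def paired_append)
      moreover have "U \<noteq> []" using e length_perms [OF perm] assms by auto
      ultimately show False using lt by (cases U) auto
    qed
    moreover from this have "even (length U)" using length_perms [OF perm] assms by auto
    moreover obtain V' y where V: "V = V' @ [y]"
      using \<open>odd (length V)\<close> by (cases V rule: rev_cases) auto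
    ultimately have "(U, V) \<in> splits N"
      using w perm by (auto simp: splits_def W_def wVU paired_append)
    then show "w \<in> ?\<phi> ` splits N" using wVU by force
  qed
  have "(\<Sum>w\<in>W (Suc N). F (des w)) = (\<Sum>s\<in>splits N. F (des (?\<phi> s)))"
    unfolding img sum.reindex [OF inj] comp_def ..
  also have "\<dots> = (\<Sum>(U, V)\<in>splits N. F (des U + des V + of_bool (U \<noteq> [])))"
  proof (rule sum.cong [OF refl], clarify)
    fix U V assume "(U, V) \<in> splits N"
    note D = splitD [OF this]
    have "des (Suc N # U) = des U + of_bool (U \<noteq> [])" using D by (cases U) auto
    moreover have "last V < Suc N" using D by simp
    ultimately show "F (des (V @ Suc N # U)) = F (des U + des V + of_bool (U \<noteq> []))"
      by (simp add: des_append ac_simps)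
  qed
  also have "\<dots> = (\<Sum>p\<in>W N. \<Sum>m\<in>{0..N div 2}.
      F (des (take (2 * m) p) + des (drop (2 * m) p) + of_bool (take (2 * m) p \<noteq> [])))"
    by (rule sum_splits)
  also have "\<dots> = (\<Sum>p\<in>W N. (int (des p) + 1) * F (des p)
      + (int (N div 2) - int (des p)) * F (Suc (des p)))"
  proof (rule sum.cong [OF refl])
    fix p assume p: "p \<in> W N"
    let ?D = "\<lambda>m. of_bool (p ! (2 * m) < p ! (2 * m - 1)) :: int"
    \<comment> \<open>Each summand is made affine in the indicator \<open>?D m\<close>, whose sum
      over \<open>m\<close> is \<open>des p\<close> by \<open>des_eq_sum\<close>.\<close>
    have "(\<Sum>m\<in>{1..N div 2}.
        F (des (take (2 * m) p) + des (drop (2 * m) p) + of_bool (take (2 * m) p \<noteq> [])))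
      = (\<Sum>m\<in>{1..N div 2}. F (Suc (des p)) + ?D m * (F (des p) - F (Suc (des p))))"
    proof (rule sum.cong [OF refl])
      fix m assume m: "m \<in> {1..N div 2}"
      then have "2 * m < N" using assms by (auto elim!: oddE)
      then show "F (des (take (2 * m) p) + des (drop (2 * m) p) + of_bool (take (2 * m) p \<noteq> []))
        = F (Suc (des p)) + ?D m * (F (des p) - F (Suc (des p)))"
        using des_take_drop [of "2 * m" p] m length_W [OF p] by auto
    qed
    also have "\<dots> = int (N div 2) * F (Suc (des p)) + int (des p) * (F (des p) - F (Suc (des p)))"
    proof -
      \<comment> \<open>For odd \<open>N\<close> the nonzero cuts are thus exactly the positions
        summed over in \<open>des_eq_sum\<close>.\<close>
      have "N div 2 = (N - 1) div 2" using assms by (auto elim!: oddE)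
      then show ?thesis
        by (simp add: sum.distrib des_eq_sum [OF p] flip: sum_distrib_right)
    qed
    finally show "(\<Sum>m\<in>{0..N div 2}.
        F (des (take (2 * m) p) + des (drop (2 * m) p) + of_bool (take (2 * m) p \<noteq> [])))
      = (int (des p) + 1) * F (des p) + (int (N div 2) - int (des p)) * F (Suc (des p))"
      by (simp add: sum.atLeast_Suc_atMost [of 0] algebra_simps)
  qed
  finally show ?thesis .
qed

section \<open>Inserting the maximum into words of even length\<close>

lemma sum_of_bool_split:
  fixes f :: "'a \<Rightarrow> int"
  assumes "finite A"
  shows "(\<Sum>x\<in>{x \<in> A. P x}. f x) = (\<Sum>x\<in>A. of_bool (P x) * f x)"
proof -
  have "(\<Sum>x\<in>A. of_bool (P x) * f x) = (\<Sum>x\<in>A. if P x then f x else 0)"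
    by (rule sum.cong) auto
  then show ?thesis using assms by (simp add: sum.inter_filter)
qed

text \<open>With \<open>d = des p\<close>, appending the maximum gives \<open>F d\<close> and the
  two outer cuts give \<open>F (d + 1)\<close> each. The \<open>d\<close> cuts at descents give
  \<open>F d + F (d + 1)\<close> each, and the other \<open>n - 1 - d\<close> inner cuts give
  \<open>F (d + 1) + F (d + 2)\<close> each.\<close>

lemma sum_des_even:
  fixes F :: "nat \<Rightarrow> int"
  assumes N: "N = 2 * n" and n: "0 < n"
  shows "(\<Sum>w\<in>W (Suc N). F (des w))
    = (\<Sum>p\<in>W N. (int (des p) + 1) * F (des p) + (int n + 1) * F (Suc (des p))
        + (int n - 1 - int (des p)) * F (Suc (Suc (des p))))"
proof -
  let ?M = "Suc N"
  \<comment> \<open>The three cases for the maximum: \<open>\<phi>0\<close> puts it last,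
    \<open>\<phi>1\<close> has the larger of the two last letters directly before it, and
    \<open>\<phi>2\<close> has that letter at the end of the word.\<close>
  define \<phi>0 where "\<phi>0 = (\<lambda>p. p @ [?M])"
  define \<phi>1 where "\<phi>1 = (\<lambda>(U, V). (U @ [last V]) @ ?M # butlast V)"
  define \<phi>2 where "\<phi>2 = (\<lambda>(U, V). butlast U @ ?M # (V @ [last U]))"
  define S1 where "S1 = {s \<in> splits N. snd s \<noteq> []}"
  define S2 where "S2 = {s \<in> splits N. fst s \<noteq> []}"
  \<comment> \<open>A nonempty \<open>V\<close> has even length here and therefore ends in a
    complete pair \<open>x < y\<close>, from which \<open>y\<close> is the letter to be
    moved.\<close>
  have S1E: "\<exists>V' x y. V = V' @ [x, y] \<and> even (length V') \<and> even (length U) \<and> x < y \<and>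
      paired U \<and> paired V' \<and> U @ V \<in> perms N \<and> (\<forall>z\<in>set U \<union> set V. z < ?M)"
    if "(U, V) \<in> S1" for U V
  proof -
    have s: "U @ V \<in> W N" "even (length U)" "V \<noteq> []"
      using that by (auto simp: splits_def S1_def)
    then have ev: "even (length V)" using length_W [of "U @ V" N] N by simp presburger
    obtain V1 y where "V = V1 @ [y]" using s(3) by (cases V rule: rev_cases) auto
    moreover obtain V' x where "V1 = V' @ [x]"
      using ev calculation by (cases V1 rule: rev_cases) auto
    ultimately show ?thesis using s ev by (auto simp: W_def perms_def paired_append)
  qed
  have S2E: "\<exists>U' y x. U = U' @ [y, x] \<and> even (length U') \<and> even (length V) \<and> y < x \<and>
      paired V \<and> paired U' \<and> U @ V \<in> perms N \<and> (\<forall>z\<in>set U \<union> set V. z < ?M)"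
    if "(U, V) \<in> S2" for U V
  proof -
    have s: "U @ V \<in> W N" "even (length U)" "U \<noteq> []"
      using that by (auto simp: splits_def S2_def)
    then have "even (length V)" using length_W [of "U @ V" N] N by simp presburger
    \<comment> \<open>Since both lengths are even, exchanging the factors again gives a valid cut,
      which reduces the claim to \<open>S1E\<close>.\<close>
    then have "(V, U) \<in> S1"
      using s by (auto simp: splits_def S1_def W_def perms_def paired_append)
    moreover have "U @ V \<in> perms N" using s by (simp add: W_def)
    ultimately show ?thesis using S1E [of V U] by auto
  qed
  have inj0: "inj_on \<phi>0 (W N)" by (auto simp: inj_on_def \<phi>0_def)
  have inj1: "inj_on \<phi>1 S1"
  proof (rule inj_onI, clarify)
    fix U V U' V'
    assume s: "(U, V) \<in> S1" "(U', V') \<in> S1" and eq: "\<phi>1 (U, V) = \<phi>1 (U', V')"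
    have M: "?M \<notin> set (U @ [last V])" "?M \<notin> set (U' @ [last V'])"
        "?M \<notin> set (butlast V)" "?M \<notin> set (butlast V')" and ne: "V \<noteq> []" "V' \<noteq> []"
      using S1E [OF s(1)] S1E [OF s(2)] by (auto simp: butlast_append)
    have "U @ [last V] = U' @ [last V'] \<and> butlast V = butlast V'"
      using eq M unfolding \<phi>1_def prod.case by (metis append_Cons_eq_iff)
    then show "U = U' \<and> V = V'" using ne by (metis append1_eq_conv append_butlast_last_id)
  qed
  have inj2: "inj_on \<phi>2 S2"
  proof (rule inj_onI, clarify)
    fix U V U' V'
    assume s: "(U, V) \<in> S2" "(U', V') \<in> S2" and eq: "\<phi>2 (U, V) = \<phi>2 (U', V')"
    have M: "?M \<notin> set (V @ [last U])" "?M \<notin> set (V' @ [last U'])"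
        "?M \<notin> set (butlast U)" "?M \<notin> set (butlast U')" and ne: "U \<noteq> []" "U' \<noteq> []"
      using S2E [OF s(1)] S2E [OF s(2)] by (auto simp: butlast_append)
    have "V @ [last U] = V' @ [last U'] \<and> butlast U = butlast U'"
      using eq M unfolding \<phi>2_def prod.case by (metis append_Cons_eq_iff)
    then show "U = U' \<and> V = V'" using ne by (metis append1_eq_conv append_butlast_last_id)
  qed
  have disj0: "\<phi>0 ` W N \<inter> (\<phi>1 ` S1 \<union> \<phi>2 ` S2) = {}"
  proof -
    have "last w \<noteq> ?M" if "w \<in> \<phi>1 ` S1 \<union> \<phi>2 ` S2" for w
      using that by (auto simp: \<phi>1_def \<phi>2_def butlast_append dest!: S1E S2E)
    moreover have "last w = ?M" if "w \<in> \<phi>0 ` W N" for w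
      using that by (auto simp: \<phi>0_def)
    ultimately show ?thesis by blast
  qed
  \<comment> \<open>The letter before the maximum is larger than the last letter of the word under
    \<open>\<phi>1\<close> and smaller under \<open>\<phi>2\<close>.\<close>
  have disj12: "\<phi>1 ` S1 \<inter> \<phi>2 ` S2 = {}"
  proof -
    have False if s: "(U, V) \<in> S1" "(U', V') \<in> S2" and eq: "\<phi>1 (U, V) = \<phi>2 (U', V')" for U V U' V'
    proof -
      obtain v x y where V: "V = v @ [x, y]" "x < y" "\<forall>z\<in>set U \<union> set V. z < ?M"
        using S1E [OF s(1)] by blast
      obtain u y' x' where U': "U' = u @ [y', x']" "y' < x'" "\<forall>z\<in>set U' \<union> set V'. z < ?M"
        using S2E [OF s(2)] by blast
      have "(U @ [y]) @ ?M # (v @ [x]) = (u @ [y']) @ ?M # (V' @ [x'])"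
        using eq by (simp add: \<phi>1_def \<phi>2_def V U' butlast_append)
      moreover have "?M \<notin> set U \<union> set V" "?M \<notin> set U' \<union> set V'"
        using V(3) U'(3) by blast+
      then have "?M \<notin> set (U @ [y])" "?M \<notin> set (v @ [x])"
          "?M \<notin> set (u @ [y'])" "?M \<notin> set (V' @ [x'])"
        using V U' by auto
      ultimately have "U @ [y] = u @ [y'] \<and> v @ [x] = V' @ [x']"
        by (metis append_Cons_eq_iff)
      then show False using V(2) U'(2) by auto
    qed
    then show ?thesis by auto
  qed
  have "W ?M = \<phi>0 ` W N \<union> (\<phi>1 ` S1 \<union> \<phi>2 ` S2)"
  proof (intro equalityI subsetI)
    fix w assume w: "w \<in> W ?M"
    then have "?M \<in> set w" by (auto simp: W_def perms_def)
    then obtain P Q where wPQ: "w = P @ ?M # Q" by (meson split_list)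
    have perm: "Q @ P \<in> perms N" using w by (simp add: wPQ W_def in_perms_Suc)
    then have len: "length P + length Q = 2 * n"
      using length_perms [OF perm] N by simp
    have lt: "\<forall>x\<in>set P \<union> set Q. x < ?M"
      using less_Suc_if_perms [OF perm] by auto
    show "w \<in> \<phi>0 ` W N \<union> (\<phi>1 ` S1 \<union> \<phi>2 ` S2)"
    proof (cases "even (length P)")
      case True
      then have pr: "paired P" "paired (?M # Q)" using w by (auto simp: wPQ W_def paired_append)
      \<comment> \<open>The maximum stands at an odd position and cannot open an ascending
        pair.\<close>
      then have "Q = []" using lt by (cases Q) auto
      then show ?thesis using pr perm by (auto simp: wPQ \<phi>0_def W_def)
    next
      case False
      then have "odd (length Q)" using len by presburger
      obtain u y where P: "P = u @ [y]" using False by (cases P rule: rev_cases) auto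
      obtain v x where Q: "Q = v @ [x]"
        using \<open>odd (length Q)\<close> by (cases Q rule: rev_cases) auto
      have ev: "even (length u)" "even (length v)"
        using False \<open>odd (length Q)\<close> by (auto simp: P Q)
      have pr: "paired u" "paired v"
        using w ev by (auto simp: wPQ P Q W_def paired_append)
      have "x \<noteq> y" using perm by (auto simp: P Q perms_def)
      \<comment> \<open>The larger of \<open>x\<close> and \<open>y\<close> returns to the end of
        the other factor, where it closes an ascending pair with the smaller one.\<close>
      then consider "x < y" | "y < x" by linarith
      then show ?thesis
      proof cases
        case 1
        have "(u, v @ [x, y]) \<in> S1"
          using 1 ev pr perm
          by (auto simp: S1_def splits_def W_def perms_def P Q paired_append)
        moreover have "w = \<phi>1 (u, v @ [x, y])"
          by (simp add: \<phi>1_def wPQ P Q butlast_append)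
        ultimately show ?thesis by blast
      next
        case 2
        have "(u @ [y, x], v) \<in> S2"
          using 2 ev pr perm
          by (auto simp: S2_def splits_def W_def perms_def P Q paired_append)
        moreover have "w = \<phi>2 (u @ [y, x], v)"
          by (simp add: \<phi>2_def wPQ P Q butlast_append)
        ultimately show ?thesis by blast
      qed
    qed
  next
    fix w assume "w \<in> \<phi>0 ` W N \<union> (\<phi>1 ` S1 \<union> \<phi>2 ` S2)"
    then consider p where "p \<in> W N" "w = \<phi>0 p" | U V where "(U, V) \<in> S1" "w = \<phi>1 (U, V)"
      | U V where "(U, V) \<in> S2" "w = \<phi>2 (U, V)"
      by auto
    then show "w \<in> W ?M"
    proof cases
      case 1
      then show ?thesis
        using N in_perms_Suc [of p N "[]"] length_W [of p N]
        by (auto simp: \<phi>0_def W_def paired_append)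
    next
      case 2
      obtain v x y where V: "V = v @ [x, y]" "even (length v)" "even (length U)"
          "paired U" "paired v" "U @ V \<in> perms N" "\<forall>z\<in>set U \<union> set V. z < ?M"
        using S1E [OF 2(1)] by auto
      have "butlast V @ U @ [last V] \<in> perms N"
        using V by (auto simp: perms_def butlast_append)
      moreover have "y < ?M" using S1E [OF 2(1)] V(1) by auto
      ultimately show ?thesis
        using V 2(2) in_perms_Suc [of "U @ [y]" N "v @ [x]"]
        by (auto simp: \<phi>1_def W_def paired_append butlast_append)
    next
      case 3
      obtain u y x where U: "U = u @ [y, x]" "even (length u)" "even (length V)"
          "paired V" "paired u" "U @ V \<in> perms N" "\<forall>z\<in>set U \<union> set V. z < ?M"
        using S2E [OF 3(1)] by auto
      have "(V @ [x]) @ u @ [y] \<in> perms N"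
        using U by (auto simp: perms_def)
      moreover have "y < ?M" using U by auto
      ultimately show ?thesis
        using U 3(2) in_perms_Suc [of "u @ [y]" N "V @ [x]"]
        by (auto simp: \<phi>2_def W_def paired_append butlast_append)
    qed
  qed
  then have "(\<Sum>w\<in>W ?M. F (des w)) = (\<Sum>w\<in>\<phi>0 ` W N. F (des w))
      + ((\<Sum>w\<in>\<phi>1 ` S1. F (des w)) + (\<Sum>w\<in>\<phi>2 ` S2. F (des w)))"
    using disj0 disj12 by (simp add: sum.union_disjoint S1_def S2_def)
  also have "(\<Sum>w\<in>\<phi>0 ` W N. F (des w)) = (\<Sum>p\<in>W N. F (des p))"
  proof -
    have "des (\<phi>0 p) = des p" if "p \<in> W N" for p
    proof (cases "p = []")
      case False
      then have "last p \<in> {1..N}" using that by (metis (lifting) W_def last_in_set mem_Collect_eq perms_def)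
      then show ?thesis by (simp add: \<phi>0_def des_append)
    qed (simp add: \<phi>0_def)
    then show ?thesis by (simp add: sum.reindex [OF inj0])
  qed
  also have "(\<Sum>w\<in>\<phi>1 ` S1. F (des w))
    = (\<Sum>(U, V)\<in>S1. F (Suc (des U + des V + of_bool (U \<noteq> [] \<and> last V < last U))))"
  proof -
    \<comment> \<open>The maximum always starts a descent, as \<open>v @ [x]\<close> is nonempty.
      Dropping \<open>y\<close> from the end of \<open>V\<close> loses no descent because
      \<open>x < y\<close>, and appending it to \<open>U\<close> adds one iff
      \<open>y < last U\<close>.\<close>
    have "des (\<phi>1 (U, V)) = Suc (des U + des V + of_bool (U \<noteq> [] \<and> last V < last U))"
      if s: "(U, V) \<in> S1" for U V
    proof -
      obtain v x y where V: "V = v @ [x, y]" "x < y" "y < ?M" "\<forall>z\<in>set V. z < ?M"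
        using S1E [OF s] by auto
      have "des (?M # v @ [x]) = Suc (des (v @ [x]))" using V by (cases v) auto
      moreover have "des V = des (v @ [x])"
        using V(2) des_append [of "v @ [x]" "[y]"] by (simp add: V(1))
      ultimately show ?thesis
        using V(2,3) by (simp add: \<phi>1_def V(1) butlast_append des_append)
    qed
    then show ?thesis by (auto simp: sum.reindex [OF inj1] intro!: sum.cong)
  qed
  also have "(\<Sum>w\<in>\<phi>2 ` S2. F (des w))
    = (\<Sum>(U, V)\<in>S2. F (Suc (des U + des V + of_bool (V \<noteq> [] \<and> last U < last V))))"
  proof -
    have "des (\<phi>2 (U, V)) = Suc (des U + des V + of_bool (V \<noteq> [] \<and> last U < last V))"
      if s: "(U, V) \<in> S2" for U V
    proof -
      obtain u y x where U: "U = u @ [y, x]" "y < x" "x < ?M" "\<forall>z\<in>set V. z < ?M"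
        using S2E [OF s] by auto
      have "des (?M # V @ [x]) = Suc (des (V @ [x]))" using U by (cases V) auto
      moreover have "des U = des (u @ [y])"
        using U(2) des_append [of "u @ [y]" "[x]"] by (simp add: U(1))
      ultimately show ?thesis
        using U(2,3) des_append [of "u @ [y]" "?M # V @ [x]"]
        by (simp add: \<phi>2_def U(1) butlast_append des_append [of V])
    qed
    then show ?thesis by (auto simp: sum.reindex [OF inj2] intro!: sum.cong)
  qed
  \<comment> \<open>Indicators extend the sums over \<open>S1\<close> and \<open>S2\<close> to all
    cuts, so that the two contributions of one cut can be combined.\<close>
  finally have "(\<Sum>w\<in>W ?M. F (des w)) = (\<Sum>p\<in>W N. F (des p)) +
    (\<Sum>(U, V)\<in>splits N.
      of_bool (V \<noteq> []) * F (Suc (des U + des V + of_bool (U \<noteq> [] \<and> last V < last U)))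
    + of_bool (U \<noteq> []) * F (Suc (des U + des V + of_bool (V \<noteq> [] \<and> last U < last V))))"
    by (simp add: S1_def S2_def sum_of_bool_split case_prod_beta sum.distrib)
  also have "(\<Sum>(U, V)\<in>splits N.
      of_bool (V \<noteq> []) * F (Suc (des U + des V + of_bool (U \<noteq> [] \<and> last V < last U)))
    + of_bool (U \<noteq> []) * F (Suc (des U + des V + of_bool (V \<noteq> [] \<and> last U < last V))))
    = (\<Sum>(U, V)\<in>splits N. if U = [] \<or> V = [] then F (Suc (des U + des V))
        else F (Suc (des U + des V)) + F (Suc (Suc (des U + des V))))"
  proof (rule sum.cong [OF refl], clarify)
    fix U V assume s: "(U, V) \<in> splits N"
    then have "last U \<noteq> last V" if "U \<noteq> []" "V \<noteq> []"
      using that by (auto simp: splits_def W_def perms_def dest!: last_in_set)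
    \<comment> \<open>This uses \<open>0 < n\<close>: for two empty factors the left-hand side would
      vanish, while the right-hand side would be \<open>F (Suc 0)\<close>.\<close>
    moreover have "U \<noteq> [] \<or> V \<noteq> []"
      using s n N length_W [of "[]" N] by (auto simp: splits_def)
    ultimately show "of_bool (V \<noteq> []) * F (Suc (des U + des V + of_bool (U \<noteq> [] \<and> last V < last U)))
      + of_bool (U \<noteq> []) * F (Suc (des U + des V + of_bool (V \<noteq> [] \<and> last U < last V)))
      = (if U = [] \<or> V = [] then F (Suc (des U + des V))
        else F (Suc (des U + des V)) + F (Suc (Suc (des U + des V))))"
      by (cases "last U < last V") auto
  qed
  also have "\<dots> = (\<Sum>p\<in>W N. int (des p) * F (des p) + (int n + 1) * F (Suc (des p))
        + (int n - 1 - int (des p)) * F (Suc (Suc (des p))))"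
    unfolding sum_splits
  proof (rule sum.cong [OF refl])
    fix p assume p: "p \<in> W N"
    let ?G = "\<lambda>m. if take (2 * m) p = [] \<or> drop (2 * m) p = []
      then F (Suc (des (take (2 * m) p) + des (drop (2 * m) p)))
      else F (Suc (des (take (2 * m) p) + des (drop (2 * m) p)))
         + F (Suc (Suc (des (take (2 * m) p) + des (drop (2 * m) p))))"
    let ?D = "\<lambda>m. of_bool (p ! (2 * m) < p ! (2 * m - 1)) :: int"
    let ?j = "des p"
    have len: "length p = 2 * n" using length_W [OF p] N by simp
    \<comment> \<open>The outer cuts \<open>m = 0\<close> and \<open>m = n\<close> are separated
      off; they differ from each other because \<open>0 < n\<close>.\<close>
    have "{0..N div 2} = insert 0 (insert n {1..(N - 1) div 2})" using n N by auto
    then have "sum ?G {0..N div 2} = ?G 0 + ?G n + sum ?G {1..(N - 1) div 2}"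
      using n N by simp
    also have "?G 0 + ?G n = 2 * F (Suc ?j)" using len by simp
    \<comment> \<open>A cut at a descent leaves \<open>?j - 1\<close> descents in the factors and
      any other inner cut leaves \<open>?j\<close>; \<open>?D m\<close> interpolates between the two
      values.\<close>
    also have "sum ?G {1..(N - 1) div 2}
      = (\<Sum>m\<in>{1..(N - 1) div 2}. F (Suc ?j) + F (Suc (Suc ?j)) + ?D m * (F ?j - F (Suc (Suc ?j))))"
    proof (rule sum.cong [OF refl])
      fix m assume m: "m \<in> {1..(N - 1) div 2}"
      then have "0 < 2 * m" "2 * m < length p" using len N by auto
      then show "?G m = F (Suc ?j) + F (Suc (Suc ?j)) + ?D m * (F ?j - F (Suc (Suc ?j)))"
        using des_take_drop [of "2 * m" p] by auto
    qed
    also have "\<dots> = int ((N - 1) div 2) * (F (Suc ?j) + F (Suc (Suc ?j)))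
        + int ?j * (F ?j - F (Suc (Suc ?j)))"
      by (simp add: sum.distrib des_eq_sum [OF p] flip: sum_distrib_right)
    also have "int ((N - 1) div 2) = int n - 1" using n N by auto
    finally show "sum ?G {0..N div 2} = int ?j * F ?j + (int n + 1) * F (Suc ?j)
        + (int n - 1 - int ?j) * F (Suc (Suc ?j))"
      by (simp add: algebra_simps)
  qed
  finally show ?thesis
    unfolding sum.distrib [symmetric] by (simp add: algebra_simps)
qed

section \<open>Smallest and largest numbers of descents\<close>

lemma descents_empty_perm_iff:
  "xs \<in> perms n \<and> descents xs = {} \<longleftrightarrow> xs = [1..<Suc n]"
proof
  assume xs: "xs \<in> perms n \<and> descents xs = {}"
  have "xs ! i \<le> xs ! Suc i" if "Suc i < length xs" for i
  proof -
    have "Suc i \<notin> descents xs" using xs by simp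
    then show ?thesis using that by (simp add: descents_def)
  qed
  then have "sorted xs" by (simp add: sorted_iff_nth_Suc)
  moreover have "distinct xs" "set xs = set [1..<Suc n]"
    using xs by (auto simp: perms_def)
  ultimately show "xs = [1..<Suc n]" by (intro sorted_distinct_set_unique) (auto simp del: upt_Suc)
next
  assume "xs = [1..<Suc n]"
  then show "xs \<in> perms n \<and> descents xs = {}"
    by (auto simp: perms_def descents_def simp del: upt_Suc)
qed

lemma a_zero: "a n 0 = 1"
proof -
  have "{xs \<in> perms n. (\<forall>i\<in>descents xs. even i) \<and> card (descents xs) = nat 0}
      = {xs. xs \<in> perms n \<and> descents xs = {}}"
    by auto
  also have "\<dots> = {[1..<Suc n]}" by (simp only: descents_empty_perm_iff) simp
  finally show ?thesis by (simp add: a_def)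
qed

text \<open>There are \<open>(n - 1) div 2\<close> even positions below \<open>n\<close>, so the
  extreme words descend at precisely these. They start with an ascent, while
  \<open>alternating\<close> words start with a descent; the complement \<open>c\<close> exchanges
  the two kinds.\<close>

lemma a_max: "a n (int ((n - 1) div 2)) = Euler n"
proof -
  define c where "c = map (\<lambda>x. Suc n - x)"
  let ?E = "{i. 1 \<le> i \<and> i < n \<and> even i}"
  have "?E = (*) 2 ` {1..(n - 1) div 2}" by (auto elim!: evenE)
  then have cardE: "card ?E = (n - 1) div 2" by (simp add: card_image inj_on_def)
  have c_perm: "c xs \<in> perms n" and cc: "c (c xs) = xs" if "xs \<in> perms n" for xs
  proof -
    have xs: "distinct xs" "set xs = {1..n}" using that by (auto simp: perms_def)
    have "inj_on (\<lambda>x. Suc n - x) {1..n}" by (auto simp: inj_on_def)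
    moreover have "(\<lambda>x. Suc n - x) ` {1..n} = {1..n}"
    proof (intro equalityI subsetI)
      fix x assume "x \<in> {1..n}"
      then show "x \<in> (\<lambda>x. Suc n - x) ` {1..n}" by (intro image_eqI [where x = "Suc n - x"]) auto
    qed auto
    ultimately show "c xs \<in> perms n" using xs by (simp add: c_def perms_def distinct_map)
    show "c (c xs) = xs" using xs by (auto simp: c_def intro!: map_idI)
  qed
  have alt: "(\<forall>i\<in>descents xs. even i) \<and> card (descents xs) = (n - 1) div 2 \<longleftrightarrow> alternating (c xs)"
    if xs: "xs \<in> perms n" for xs
  proof -
    have len: "length xs = n" by (rule length_perms [OF xs])
    have rng: "1 \<le> xs ! i \<and> xs ! i \<le> n" if "i < n" for i
      using that xs len nth_mem [of i xs] by (auto simp: perms_def)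
    have neq: "xs ! (i - 1) \<noteq> xs ! i" if "1 \<le> i" "i < n" for i
      using that xs len by (simp add: perms_def nth_eq_iff_index_eq)
    have "(\<forall>i\<in>descents xs. even i) \<and> card (descents xs) = (n - 1) div 2 \<longleftrightarrow> descents xs = ?E"
    proof
      assume h: "(\<forall>i\<in>descents xs. even i) \<and> card (descents xs) = (n - 1) div 2"
      then have "descents xs \<subseteq> ?E" by (auto simp: descents_def len)
      \<comment> \<open>A subset of the finite set \<open>?E\<close> with the same cardinality is
        all of \<open>?E\<close>.\<close>
      then show "descents xs = ?E" using h cardE by (intro card_subset_eq) auto
    next
      assume d: "descents xs = ?E"
      show "(\<forall>i\<in>descents xs. even i) \<and> card (descents xs) = (n - 1) div 2"
        unfolding d using cardE by simp
    qed
    also have "\<dots> \<longleftrightarrow> (\<forall>i. 1 \<le> i \<and> i < n \<longrightarrow> (xs ! i < xs ! (i - 1) \<longleftrightarrow> even i))"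
      by (auto simp: descents_def len set_eq_iff)
    also have "\<dots> \<longleftrightarrow> alternating (c xs)"
    proof -
      have "(xs ! i < xs ! (i - 1) \<longleftrightarrow> even i) \<longleftrightarrow>
          (odd i \<longrightarrow> c xs ! (i - 1) > c xs ! i) \<and> (even i \<longrightarrow> c xs ! (i - 1) < c xs ! i)"
        if i: "1 \<le> i" "i < n" for i
        using rng [of i] rng [of "i - 1"] neq [OF i] i by (auto simp: c_def len)
      then show ?thesis by (auto simp: alternating_def len c_def)
    qed
    finally show ?thesis .
  qed
  have "bij_betw c {xs \<in> perms n. alternating (c xs)} {xs \<in> perms n. alternating xs}"
    by (rule bij_betw_byWitness [where f' = c]) (auto simp: cc c_perm)
  moreover have "{xs \<in> perms n. alternating (c xs)} = {xs \<in> perms n.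
      (\<forall>i\<in>descents xs. even i) \<and> card (descents xs) = (n - 1) div 2}"
    using alt by blast
  ultimately show ?thesis by (simp add: a_def Euler_def bij_betw_same_card)
qed

theorem theorem3p6:
  shows "(\<forall>n k::nat. 1 \<le> k \<and> k \<le> n \<longrightarrow>
            int (a (2*n) (int k)) = int (n - k) * int (a (2*n - 1) (int k - 1))
                                     + int (k + 1) * int (a (2*n - 1) (int k)))
       \<and> (\<forall>n k::nat. 1 \<le> k \<and> k \<le> n \<longrightarrow>
            int (a (2*n + 1) (int k)) = int (n - k + 1) * int (a (2*n) (int k - 2))
                                     + int (n + 1) * int (a (2*n) (int k - 1))
                                     + int (k + 1) * int (a (2*n) (int k)))
       \<and> (\<forall>n::nat. 1 \<le> n \<longrightarrow> a n 0 = 1)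
       \<and> (\<forall>n::nat. 1 \<le> n \<longrightarrow> a n (int ((n - 1) div 2)) = Euler n)"
proof (intro conjI allI impI; (elim conjE)?)
  fix n k :: nat assume k: "1 \<le> k" "k \<le> n"
  let ?N = "2 * n - 1"
  have N: "Suc ?N = 2 * n" "odd ?N" "int (?N div 2) = int n - 1" using k by auto
  have "int (a (2 * n) (int k)) = (\<Sum>p\<in>W ?N. (int (des p) + 1) * of_bool (des p = k)
      + (int (?N div 2) - int (des p)) * of_bool (Suc (des p) = k))"
    using sum_des_odd [OF N(2), of "\<lambda>j. of_bool (j = k)"] by (simp only: a_eq_sum N(1))
  \<comment> \<open>On words with \<open>des p = k - 1\<close> the coefficient is
    \<open>(n - 1) - (k - 1) = n - k\<close>.\<close>
  also have "\<dots> = (\<Sum>p\<in>W ?N. int (n - k) * of_bool (des p = k - 1)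
      + int (k + 1) * of_bool (des p = k))"
    unfolding N(3) using k by (intro sum.cong refl) auto
  also have "\<dots> = int (n - k) * int (a ?N (int (k - 1))) + int (k + 1) * int (a ?N (int k))"
    unfolding a_eq_sum sum_distrib_left by (rule sum.distrib)
  finally show "int (a (2*n) (int k)) = int (n - k) * int (a (2*n - 1) (int k - 1))
      + int (k + 1) * int (a (2*n - 1) (int k))"
    using k by (simp add: of_nat_diff)
next
  fix n k :: nat assume k: "1 \<le> k" "k \<le> n"
  have a2: "int (a (2 * n) (int k - 2)) = (\<Sum>p\<in>W (2 * n). of_bool (Suc (Suc (des p)) = k))"
  proof (cases "k = 1")
    \<comment> \<open>For \<open>k = 1\<close> the index \<open>int k - 2\<close> is negative, so
      \<open>a\<close> is 0 by convention; the sum is 0 as well, since no double successor equals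
      1.\<close>
    case True
    then show ?thesis by (simp add: a_def)
  next
    case False
    then have "int k - 2 = int (k - 2)" "\<And>j. Suc (Suc j) = k \<longleftrightarrow> j = k - 2" using k by auto
    then show ?thesis by (simp only: a_eq_sum)
  qed
  have a1: "int (a (2 * n) (int k - 1)) = (\<Sum>p\<in>W (2 * n). of_bool (Suc (des p) = k))"
  proof -
    have "int k - 1 = int (k - 1)" "\<And>j. Suc j = k \<longleftrightarrow> j = k - 1" using k by auto
    then show ?thesis by (simp only: a_eq_sum)
  qed
  have "int (a (2 * n + 1) (int k)) = (\<Sum>p\<in>W (2 * n). (int (des p) + 1) * of_bool (des p = k)
      + (int n + 1) * of_bool (Suc (des p) = k)
      + (int n - 1 - int (des p)) * of_bool (Suc (Suc (des p)) = k))"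
    using sum_des_even [OF refl, of n "\<lambda>j. of_bool (j = k)"] k
    by (simp only: a_eq_sum Suc_eq_plus1 [symmetric])
  \<comment> \<open>On words with \<open>des p = k - 2\<close> the coefficient is
    \<open>n - 1 - (k - 2) = n - k + 1\<close>.\<close>
  also have "\<dots> = (\<Sum>p\<in>W (2 * n). int (n - k + 1) * of_bool (Suc (Suc (des p)) = k)
      + int (n + 1) * of_bool (Suc (des p) = k) + int (k + 1) * of_bool (des p = k))"
    using k by (intro sum.cong refl) auto
  also have "\<dots> = int (n - k + 1) * int (a (2*n) (int k - 2))
      + int (n + 1) * int (a (2*n) (int k - 1)) + int (k + 1) * int (a (2*n) (int k))"
    unfolding a1 a2 a_eq_sum sum_distrib_left by (simp only: sum.distrib)
  finally show "int (a (2*n + 1) (int k)) = int (n - k + 1) * int (a (2*n) (int k - 2))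
      + int (n + 1) * int (a (2*n) (int k - 1)) + int (k + 1) * int (a (2*n) (int k))" .
qed (rule a_zero, rule a_max)

end
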